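(* Let $r\geq t\geq 3$ be integers, let $n_1\geq n_2\geq\cdots\geq n_r\geq 1$, and let $\mathcal{V}=(V_1,\ldots,V_r)$ be a partition of a set $V$ with $|V_i|=n_i$ for $i\in[r]$. A partition $\mathcal{P}=(P_1,\ldots,P_{t-1})$ of $V$ into $t-1$ classes is an extremal $(t-1)$-partition for $\mathcal{V}$ if and only if both of the following hold: (i) $\mathcal{P}$ is stable to $\mathcal{V}$; (ii) the internalization $I(\mathcal{P})$ is also an extremal $(t-1)$-partition for $\mathcal{V}$.
   Context: $K_{n_1,\ldots,n_r}$ denotes the complete $r$-partite graph on $V$ with parts $V_1,\ldots,V_r$. For $I\subseteq[r]$ let $n_I=\sum_{i\in I}n_i$. Define $f(n_1,\ldots,n_r,1,t)=\max_{\mathcal{Q}}\sum n_I n_{I'}$, where the maximum is over all partitions $\mathcal{Q}$ of $[r]$ into $t-1$ parts and the sum is over unordered pairs $\{I,I'\}$ of distinct parts of $\mathcal{Q}$. For a partition $\mathcal{P}=(P_1,\ldots,P_{t-1})$ of $V$, $K_{n_1,\ldots,n_r}[\mathcal{P}]$ is the spanning subgraph of $K_{n_1,\ldots,n_r}$ consisting of the edges $xy$ with $x,y$ in different classes of $\mathcal{P}$ (and, being edges of $K_{n_1,\ldots,n_r}$, in different classes of $\mathcal{V}$). $\mathcal{P}$ is an extremal $(t-1)$-partition for $\mathcal{V}$ if $e(K_{n_1,\ldots,n_r}[\mathcal{P}])=f(n_1,\ldots,n_r,1,t)$. $V_i$ is integral in $P_j$ if $V_i\subseteq P_j$, and partial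 in $P_j$ if $V_i\cap P_j\neq\emptyset$ and $V_i\not\subseteq P_j$; $V_i$ is a partial class of $\mathcal{V}$ if it is partial in some $P_j$. The integral part of $P_j$ is the union of the $V_i$ integral in $P_j$; the partial part of $P_j$ is the union of the sets $V_i\cap P_j$ over the $V_i$ partial in $P_j$. $P_j$ is a partial class of $\mathcal{P}$ if its partial part is nonempty, and an integral class otherwise. $\mathcal{P}$ is 1-partial to $\mathcal{V}$ if each $P_j$ has at most one $V_i$ partial in it. $\mathcal{P}$ is stable to $\mathcal{V}$ if: (1) $\mathcal{P}$ is 1-partial to $\mathcal{V}$; (2) the integral parts of all partial classes of $\mathcal{P}$ have the same size, and this size is at most the size of every integral class of $\mathcal{P}$; (3) the size of the integral part of every class of $\mathcal{P}$ is at least the size of every partial class $V_i$ of $\mathcal{V}$; (4) for every $j$ and every $V_i$ integral in $P_j$, $|P_j\setminus V_i|$ is at most the size of the integral part of every other class $P_{j'}$, $j'\neq j$. The internalization $I(\mathcal{P})$ is the partition obtained from $\mathcal{P}$ by moving, for each partial $V_i$, all vertices of $V_i$ into one class $P_j$ containing some vertices of $V_i$. *)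

theory Defs
  imports Main "HOL-Library.Disjoint_Sets"
begin

text \<open>
  An ordered partition \<open>(P\<^sub>1, \<dots>, P\<^sub>m)\<close> is a function on \<open>nat\<close>, of which only the
  values at \<open>1, \<dots>, m\<close> matter. As usual for tuples of classes, a class may be empty: an
  internalization can empty a class of an arbitrary \<open>\<P>\<close>. Where nonemptiness is wanted, it
  is assumed explicitly (\<open>n\<^sub>r \<ge> 1\<close> for \<open>\<V>\<close>).
\<close>

definition family_partition :: "'a set \<Rightarrow> nat \<Rightarrow> (nat \<Rightarrow> 'a set) \<Rightarrow> bool" where
  "family_partition V m W \<longleftrightarrow> disjoint_family_on W {1..m} \<and> (\<Union>j\<in>{1..m}. W j) = V"

definition n_of :: "(nat \<Rightarrow> nat) \<Rightarrow> nat set \<Rightarrow> nat" where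
  "n_of n I = (\<Sum>i\<in>I. n i)"

text \<open>\<open>turan_f r n t\<close> is \<open>f(n\<^sub>1, \<dots>, n\<^sub>r, 1, t)\<close>.\<close>

definition turan_f :: "nat \<Rightarrow> (nat \<Rightarrow> nat) \<Rightarrow> nat \<Rightarrow> nat" where
  "turan_f r n t =
     Max {(\<Sum>S | S \<subseteq> Q \<and> card S = 2. \<Prod>I\<in>S. n_of n I) | Q.
            partition_on {1..r} Q \<and> card Q = t - 1}"

text \<open>All graphs are spanning subgraphs of one vertex set, so a graph is its set of edges.\<close>

definition complete_multipartite :: "nat \<Rightarrow> (nat \<Rightarrow> 'a set) \<Rightarrow> 'a set set" where
  "complete_multipartite m W =
     {{x, y} | x y. \<exists>i\<in>{1..m}. \<exists>j\<in>{1..m}. i \<noteq> j \<and> x \<in> W i \<and> y \<in> W j}"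

definition cross_subgraph :: "'a set set \<Rightarrow> nat \<Rightarrow> (nat \<Rightarrow> 'a set) \<Rightarrow> 'a set set" where
  "cross_subgraph E m P =
     {e \<in> E. \<exists>x y. e = {x, y} \<and> (\<exists>i\<in>{1..m}. \<exists>j\<in>{1..m}. i \<noteq> j \<and> x \<in> P i \<and> y \<in> P j)}"

definition extremal_partition ::
    "'a set \<Rightarrow> nat \<Rightarrow> (nat \<Rightarrow> nat) \<Rightarrow> (nat \<Rightarrow> 'a set) \<Rightarrow> nat \<Rightarrow> (nat \<Rightarrow> 'a set) \<Rightarrow> bool" where
  "extremal_partition V r n \<V> t \<P> \<longleftrightarrow>
     family_partition V (t - 1) \<P> \<and>
     card (cross_subgraph (complete_multipartite r \<V>) (t - 1) \<P>) = turan_f r n t"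

text \<open>Below, \<open>\<V>\<close> has the classes \<open>1, \<dots>, r\<close> and \<open>\<P>\<close> has the classes \<open>1, \<dots>, m\<close>.\<close>

definition integral_in :: "'a set \<Rightarrow> 'a set \<Rightarrow> bool" where
  "integral_in A B \<longleftrightarrow> A \<subseteq> B"

definition partial_in :: "'a set \<Rightarrow> 'a set \<Rightarrow> bool" where
  "partial_in A B \<longleftrightarrow> A \<inter> B \<noteq> {} \<and> \<not> A \<subseteq> B"

definition partial_indices :: "nat \<Rightarrow> (nat \<Rightarrow> 'a set) \<Rightarrow> nat \<Rightarrow> (nat \<Rightarrow> 'a set) \<Rightarrow> nat set" where
  "partial_indices r \<V> m \<P> = {i \<in> {1..r}. \<exists>j\<in>{1..m}. partial_in (\<V> i) (\<P> j)}"

definition integral_part :: "nat \<Rightarrow> (nat \<Rightarrow> 'a set) \<Rightarrow> 'a set \<Rightarrow> 'a set" where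
  "integral_part r \<V> B = \<Union>{\<V> i | i. i \<in> {1..r} \<and> integral_in (\<V> i) B}"

definition partial_part :: "nat \<Rightarrow> (nat \<Rightarrow> 'a set) \<Rightarrow> 'a set \<Rightarrow> 'a set" where
  "partial_part r \<V> B = \<Union>{\<V> i \<inter> B | i. i \<in> {1..r} \<and> partial_in (\<V> i) B}"

definition is_partial_class :: "nat \<Rightarrow> (nat \<Rightarrow> 'a set) \<Rightarrow> 'a set \<Rightarrow> bool" where
  "is_partial_class r \<V> B \<longleftrightarrow> partial_part r \<V> B \<noteq> {}"

definition is_integral_class :: "nat \<Rightarrow> (nat \<Rightarrow> 'a set) \<Rightarrow> 'a set \<Rightarrow> bool" where
  "is_integral_class r \<V> B \<longleftrightarrow> \<not> is_partial_class r \<V> B"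

definition one_partial :: "nat \<Rightarrow> (nat \<Rightarrow> 'a set) \<Rightarrow> nat \<Rightarrow> (nat \<Rightarrow> 'a set) \<Rightarrow> bool" where
  "one_partial r \<V> m \<P> \<longleftrightarrow>
     (\<forall>j\<in>{1..m}. card {i \<in> {1..r}. partial_in (\<V> i) (\<P> j)} \<le> 1)"

definition stable_to :: "nat \<Rightarrow> (nat \<Rightarrow> 'a set) \<Rightarrow> nat \<Rightarrow> (nat \<Rightarrow> 'a set) \<Rightarrow> bool" where
  "stable_to r \<V> m \<P> \<longleftrightarrow>
     one_partial r \<V> m \<P> \<and>
     (\<forall>j\<in>{1..m}. is_partial_class r \<V> (\<P> j) \<longrightarrow>
        (\<forall>j'\<in>{1..m}. is_partial_class r \<V> (\<P> j') \<longrightarrow>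
           card (integral_part r \<V> (\<P> j)) = card (integral_part r \<V> (\<P> j'))) \<and>
        (\<forall>j'\<in>{1..m}. is_integral_class r \<V> (\<P> j') \<longrightarrow>
           card (integral_part r \<V> (\<P> j)) \<le> card (\<P> j'))) \<and>
     (\<forall>j\<in>{1..m}. \<forall>i\<in>partial_indices r \<V> m \<P>.
        card (integral_part r \<V> (\<P> j)) \<ge> card (\<V> i)) \<and>
     (\<forall>j\<in>{1..m}. \<forall>i\<in>{1..r}. integral_in (\<V> i) (\<P> j) \<longrightarrow>
        (\<forall>j'\<in>{1..m}. j' \<noteq> j \<longrightarrow>
           card (\<P> j - \<V> i) \<le> card (integral_part r \<V> (\<P> j'))))"

text \<open>
  The internalization depends on the choice, for each partial \<open>\<V> i\<close>, of a class \<open>\<P> (c i)\<close>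
  meeting \<open>\<V> i\<close> that receives it. \<open>internalization r \<V> m \<P> Q\<close> says that \<open>Q\<close> arises from
  \<open>\<P>\<close> by some such choice.
\<close>

definition internalization ::
    "nat \<Rightarrow> (nat \<Rightarrow> 'a set) \<Rightarrow> nat \<Rightarrow> (nat \<Rightarrow> 'a set) \<Rightarrow> (nat \<Rightarrow> 'a set) \<Rightarrow> bool" where
  "internalization r \<V> m \<P> Q \<longleftrightarrow>
     (\<exists>c. (\<forall>i\<in>partial_indices r \<V> m \<P>. c i \<in> {1..m} \<and> \<V> i \<inter> \<P> (c i) \<noteq> {}) \<and>
          (\<forall>j\<in>{1..m}.
             Q j = (\<P> j - (\<Union>i\<in>partial_indices r \<V> m \<P>. \<V> i))
                   \<union> (\<Union>i\<in>{i \<in> partial_indices r \<V> m \<P>. c i = j}. \<V> i)))"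

lemma internalization_exists: "\<exists>Q. internalization r \<V> m \<P> Q"
proof -
  have "\<forall>i\<in>partial_indices r \<V> m \<P>. \<exists>j. j \<in> {1..m} \<and> \<V> i \<inter> \<P> j \<noteq> {}"
    unfolding partial_indices_def partial_in_def by blast
  then obtain c where "\<forall>i\<in>partial_indices r \<V> m \<P>. c i \<in> {1..m} \<and> \<V> i \<inter> \<P> (c i) \<noteq> {}"
    by metis
  then show ?thesis
    unfolding internalization_def
    by (intro exI[of _ "\<lambda>j. (\<P> j - (\<Union>i\<in>partial_indices r \<V> m \<P>. \<V> i))
          \<union> (\<Union>i\<in>{i \<in> partial_indices r \<V> m \<P>. c i = j}. \<V> i)"] exI[of _ c]) simp
qed

end

theory Submission
  imports Defs
begin

text \<open>
  Since no two vertices of \<open>\<V> i\<close> are adjacent, the edge count depends linearly on how the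
  vertices of \<open>\<V> i\<close> are distributed: each vertex of \<open>\<V> i\<close> put into \<open>\<P> j\<close> loses
  \<open>card (\<P> j - \<V> i)\<close> edges. Hence in an edge-maximal partition every vertex sits in a
  class minimising this loss, and any part of \<open>\<V> i\<close> may be moved freely among the classes
  that \<open>\<V> i\<close> meets. Moving whole classes shows that the maximum is attained by an integral
  partition, hence equals \<open>turan_f\<close>; moving one partial class out of some \<open>\<P> j\<close> leaves just
  its integral part, and comparing losses in the new partition gives each condition of
  stability. Conversely, stability alone makes the losses over the classes that \<open>\<V> i\<close> meets
  equal, so internalizing preserves the edge count.
\<close>

section \<open>Sums over two-element subsets\<close>

text \<open>Each two-element set \<open>{a, b}\<close> comes from exactly the ordered pairs
  \<open>(a, b)\<close> and \<open>(b, a)\<close>, so its fibre contributes \<open>h\<close> twice.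
  Applied to the pairs of parts in \<open>turan_f\<close> and to the edges of a graph.\<close>

lemma sum_two_subsets:
  fixes h :: "'b set \<Rightarrow> nat"
  assumes "finite A"
  shows "2 * (\<Sum>S | S \<subseteq> A \<and> card S = 2. h S) = (\<Sum>x\<in>A. \<Sum>y\<in>A. if x = y then 0 else h {x, y})"
proof -
  let ?D = "{(x, y) \<in> A \<times> A. x \<noteq> y}"
  let ?T = "{S. S \<subseteq> A \<and> card S = 2}"
  let ?g = "\<lambda>(x, y). {x, y}"
  have fD: "finite ?D" by (rule finite_subset[of _ "A \<times> A"]) (use assms in auto)
  have fT: "finite ?T" using assms by simp
  have sub: "?g ` ?D \<subseteq> ?T" by auto
  have fibre: "(\<Sum>z | z \<in> ?D \<and> ?g z = S. h (?g z)) = 2 * h S" if S: "S \<in> ?T" for S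
  proof -
    obtain a b where ab: "S = {a, b}" "a \<noteq> b" using S by (auto simp: card_2_iff)
    have "{z. z \<in> ?D \<and> ?g z = S} = {(a, b), (b, a)}"
      using S ab by (auto simp: doubleton_eq_iff)
    then show ?thesis using ab by (simp add: insert_commute)
  qed
  have "(\<Sum>x\<in>A. \<Sum>y\<in>A. if x = y then 0 else h {x, y}) =
      (\<Sum>z\<in>A \<times> A. if fst z = snd z then 0 else h {fst z, snd z})"
    by (simp add: sum.cartesian_product case_prod_beta)
  also have "\<dots> = (\<Sum>z\<in>?D. h (?g z))"
    using assms by (intro sum.mono_neutral_cong_right) auto
  also have "\<dots> = (\<Sum>S\<in>?T. \<Sum>z | z \<in> ?D \<and> ?g z = S. h (?g z))"
    using sum.group[OF fD fT sub, of "\<lambda>z. h (?g z)"] by simp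
  also have "\<dots> = 2 * (\<Sum>S\<in>?T. h S)"
    unfolding sum_distrib_left by (intro sum.cong refl fibre)
  finally show ?thesis by simp
qed

section \<open>Colourings of a vertex set with classes\<close>

text \<open>
  The partition \<open>\<V>\<close> is given by \<open>b\<close>, sending a vertex to the index of its class, and \<open>\<P>\<close>
  by a colouring \<open>p\<close> with colours in \<open>{1..m}\<close>.
\<close>

locale classed_vertices =
  fixes V :: "'a set" and b :: "'a \<Rightarrow> nat" and m :: nat
  assumes finite_V: "finite V"
begin

text \<open>Ordered pairs are counted, so this is twice the number of edges.\<close>

definition cross :: "('a \<Rightarrow> nat) \<Rightarrow> nat" where
  "cross p = (\<Sum>x\<in>V. \<Sum>y\<in>V. of_bool (b x \<noteq> b y \<and> p x \<noteq> p y))"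

text \<open>The number of edges of the complete multipartite graph that a vertex of class
  \<open>i\<close> loses when it has colour \<open>j\<close>. It does not depend on how class
  \<open>i\<close> itself is coloured.\<close>

definition loss :: "('a \<Rightarrow> nat) \<Rightarrow> nat \<Rightarrow> nat \<Rightarrow> nat" where
  "loss p j i = card {x \<in> V. p x = j \<and> b x \<noteq> i}"

definition recolour :: "'a set \<Rightarrow> nat \<Rightarrow> ('a \<Rightarrow> nat) \<Rightarrow> 'a \<Rightarrow> nat" where
  "recolour S l p x = (if x \<in> S then l else p x)"

definition int_part :: "('a \<Rightarrow> nat) \<Rightarrow> nat \<Rightarrow> 'a set" where
  "int_part p j = {x \<in> V. p x = j \<and> (\<forall>y\<in>V. b y = b x \<longrightarrow> p y = j)}"

text \<open>The competitors \<open>q\<close> may split classes and leave colours empty, so moving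
  vertices never leaves the domain of comparison.\<close>

definition optimal :: "('a \<Rightarrow> nat) \<Rightarrow> bool" where
  "optimal p \<longleftrightarrow> p ` V \<subseteq> {1..m} \<and> (\<forall>q. q ` V \<subseteq> {1..m} \<longrightarrow> cross q \<le> cross p)"

lemma card_mono_V: "A \<subseteq> B \<Longrightarrow> B \<subseteq> V \<Longrightarrow> card A \<le> card B"
  using finite_V by (meson card_mono finite_subset)

lemma loss_mono:
  assumes "\<And>x. x \<in> V \<Longrightarrow> p x = j \<Longrightarrow> b x \<noteq> i \<Longrightarrow> q x = l \<and> b x \<noteq> k"
  shows "loss p j i \<le> loss q l k"
  unfolding loss_def by (rule card_mono_V) (use assms in auto)

lemma cross_cong:
  assumes "\<And>x. x \<in> V \<Longrightarrow> p x = q x"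
  shows "cross p = cross q"
  unfolding cross_def using assms by (auto intro!: sum.cong)

text \<open>Isolates the influence of the colours on \<open>S\<close>: \<open>S\<close> spans no
  edges, and each \<open>v\<close> in \<open>S\<close> keeps all its edges except those counted by
  its loss. The losses are added on the left to avoid subtraction on \<open>nat\<close>.\<close>

lemma cross_split:
  assumes S: "S \<subseteq> {x \<in> V. b x = i}"
  shows "cross p + 2 * (\<Sum>v\<in>S. loss p (p v) i) =
    (\<Sum>x\<in>V-S. \<Sum>y\<in>V-S. of_bool (b x \<noteq> b y \<and> p x \<noteq> p y)) + 2 * card S * card {y \<in> V. b y \<noteq> i}"
proof -
  let ?c = "\<lambda>x y. of_bool (b x \<noteq> b y \<and> p x \<noteq> p y) :: nat"
  have SV: "S \<subseteq> V" using S by auto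
  have fin: "finite S" "finite (V - S)" using finite_V SV finite_subset by auto
  have split: "sum g V = sum g (V - S) + sum g S" for g :: "'a \<Rightarrow> nat"
    using finite_V SV by (rule sum.subset_diff[rotated])
  have SS: "(\<Sum>x\<in>S. sum (?c x) S) = 0"
    using S by (intro sum.neutral ballI) (auto simp: subset_iff)
  have sym: "(\<Sum>x\<in>V-S. sum (?c x) S) = (\<Sum>x\<in>S. sum (?c x) (V - S))"
    by (subst sum.swap) (auto intro!: sum.cong)
  \<comment> \<open>The vertices outside class \<open>i\<close> all lie in \<open>V - S\<close>;
    they split by whether they share the colour of \<open>v\<close>.\<close>
  have deg: "sum (?c v) (V - S) + loss p (p v) i = card {y \<in> V. b y \<noteq> i}" if v: "v \<in> S" for v
  proof -
    have "sum (?c v) (V - S) = card {y \<in> V. b y \<noteq> i \<and> p y \<noteq> p v}"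
    proof -
      have "sum (?c v) (V - S) = card ((V - S) \<inter> {y. b v \<noteq> b y \<and> p v \<noteq> p y})"
        using fin by (simp add: sum_of_bool_eq)
      also have "(V - S) \<inter> {y. b v \<noteq> b y \<and> p v \<noteq> p y} = {y \<in> V. b y \<noteq> i \<and> p y \<noteq> p v}"
        using S v by auto
      finally show ?thesis .
    qed
    moreover have "{y \<in> V. b y \<noteq> i} =
        {y \<in> V. b y \<noteq> i \<and> p y \<noteq> p v} \<union> {y \<in> V. p y = p v \<and> b y \<noteq> i}"
      by auto
    ultimately show ?thesis
      unfolding loss_def using finite_V by (simp add: card_Un_disjoint disjoint_iff)
  qed
  have "cross p = (\<Sum>x\<in>V-S. sum (?c x) (V - S)) + 2 * (\<Sum>x\<in>S. sum (?c x) (V - S))"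
    unfolding cross_def split sum.distrib using SS sym by simp
  moreover have "(\<Sum>v\<in>S. sum (?c v) (V - S)) + (\<Sum>v\<in>S. loss p (p v) i) =
      card S * card {y \<in> V. b y \<noteq> i}"
    using deg by (simp flip: sum.distrib)
  ultimately show ?thesis by (simp add: algebra_simps)
qed

text \<open>Both colourings agree off \<open>S\<close>, so the remainders in
  \<open>cross_split\<close> cancel; the losses for class \<open>i\<close> are unaffected because
  only vertices of that class move.\<close>

lemma cross_recolour:
  assumes S: "S \<subseteq> {x \<in> V. b x = i}"
  shows "cross (recolour S l p) + 2 * card S * loss p l i = cross p + 2 * (\<Sum>v\<in>S. loss p (p v) i)"
proof -
  have "loss (recolour S l p) j i = loss p j i" for j
    unfolding loss_def recolour_def using S by (intro arg_cong[where f = card]) auto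
  then have "(\<Sum>v\<in>S. loss (recolour S l p) (recolour S l p v) i) = card S * loss p l i"
    by (simp add: recolour_def)
  moreover have "(\<Sum>x\<in>V-S. \<Sum>y\<in>V-S. of_bool (b x \<noteq> b y \<and> recolour S l p x \<noteq> recolour S l p y)) =
      (\<Sum>x\<in>V-S. \<Sum>y\<in>V-S. of_bool (b x \<noteq> b y \<and> p x \<noteq> p y) :: nat)"
    by (intro sum.cong) (auto simp: recolour_def)
  ultimately show ?thesis
    using cross_split[OF S, of p] cross_split[OF S, of "recolour S l p"] by simp
qed

section \<open>Optimal colourings\<close>

lemma optimal_range: "optimal p \<Longrightarrow> v \<in> V \<Longrightarrow> p v \<in> {1..m}"
  unfolding optimal_def by blast

text \<open>Recolouring the single vertex \<open>v\<close> changes \<open>cross\<close> by twice the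
  difference of these losses.\<close>

lemma optimal_loss_le:
  assumes "optimal p" "v \<in> V" "l \<in> {1..m}"
  shows "loss p (p v) (b v) \<le> loss p l (b v)"
proof -
  have "recolour {v} l p ` V \<subseteq> {1..m}"
    using assms unfolding optimal_def recolour_def by auto
  then have "cross (recolour {v} l p) \<le> cross p"
    using assms unfolding optimal_def by blast
  then show ?thesis
    using cross_recolour[of "{v}" "b v" l p] assms by simp
qed

lemma optimal_loss_eq:
  assumes "optimal p" "v \<in> V" "w \<in> V" "b v = b w"
  shows "loss p (p v) (b w) = loss p (p w) (b w)"
  using assms optimal_loss_le[of p v "p w"] optimal_loss_le[of p w "p v"] optimal_range[of p]
  by auto

text \<open>All vertices of one class have equal loss, so the move costs nothing. The loss
  inequalities of the new optimal colouring then yield further constraints on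
  \<open>p\<close>.\<close>

lemma optimal_recolour:
  assumes "optimal p" "w \<in> V" "S \<subseteq> {x \<in> V. b x = b w}"
  shows "optimal (recolour S (p w) p)"
proof -
  have "(\<Sum>v\<in>S. loss p (p v) (b w)) = card S * loss p (p w) (b w)"
  proof -
    have "loss p (p v) (b w) = loss p (p w) (b w)" if "v \<in> S" for v
      using that assms(3) by (intro optimal_loss_eq[OF assms(1) _ assms(2)]) auto
    then show ?thesis by simp
  qed
  then have "cross (recolour S (p w) p) = cross p"
    using cross_recolour[OF assms(3), of "p w" p] by simp
  moreover have "recolour S (p w) p ` V \<subseteq> {1..m}"
    using assms unfolding optimal_def recolour_def by auto
  ultimately show ?thesis using assms(1) unfolding optimal_def by simp
qed

text \<open>Suppose two classes were partial in one colour. Moving the share of the class of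
  \<open>x\<close> to colour \<open>p x'\<close> keeps optimality but strictly lowers the loss for
  the class of \<open>y\<close> in colour \<open>p y\<close>, and does not lower it in
  \<open>p y'\<close>. Then \<open>y'\<close> would gain by moving to \<open>p y\<close>.\<close>

lemma optimal_one_partial:
  assumes p: "optimal p" and V: "x \<in> V" "x' \<in> V" "y \<in> V" "y' \<in> V"
    and x: "b x' = b x" "p x' \<noteq> p x" and y: "b y' = b y" "p y' \<noteq> p y" and xy: "p x = p y"
  shows "b x = b y"
proof (rule ccontr)
  assume ne: "b x \<noteq> b y"
  let ?S = "{z \<in> V. b z = b x \<and> p z = p x}"
  let ?q = "recolour ?S (p x') p"
  have q: "optimal ?q" using optimal_recolour[OF p V(2), of ?S] x by auto
  have "loss ?q (p y) (b y) < loss p (p y) (b y)"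
    unfolding loss_def
    by (rule psubset_card_mono) (use finite_V V x xy ne in \<open>auto simp: recolour_def\<close>)
  also have "\<dots> = loss p (p y') (b y)" using optimal_loss_eq[OF p V(4,3)] y by simp
  also have "\<dots> \<le> loss ?q (p y') (b y)"
    by (rule loss_mono) (use y xy in \<open>auto simp: recolour_def\<close>)
  also have "\<dots> = loss ?q (?q y') (b y')" using ne y by (simp add: recolour_def)
  also have "\<dots> \<le> loss ?q (p y) (b y')"
    using optimal_loss_le[OF q V(4)] optimal_range[OF p V(3)] by blast
  finally show False using y by simp
qed

text \<open>An empty colour has loss 0, so by optimality every vertex has loss 0. Each colour then
  meets only one class, which is impossible with more classes than colours.\<close>

lemma optimal_surj:
  assumes p: "optimal p" and m: "m < card (b ` V)" and j: "j \<in> {1..m}"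
  shows "\<exists>x\<in>V. p x = j"
proof (rule ccontr)
  assume "\<not> ?thesis"
  then have none: "loss p j i = 0" for i
    unfolding loss_def using finite_V by (subst card_0_eq) auto
  have same: "b x = b y" if "x \<in> V" "y \<in> V" "p x = p y" for x y
  proof (rule ccontr)
    assume "b x \<noteq> b y"
    then have "x \<in> {z \<in> V. p z = p y \<and> b z \<noteq> b y}" using that by simp
    then have "loss p (p y) (b y) > 0" unfolding loss_def using finite_V by (auto simp: card_gt_0_iff)
    with optimal_loss_le[OF p that(2) j] none show False by simp
  qed
  \<comment> \<open>Reads off the class from a used colour; by \<open>same\<close> the choice of
    representative does not matter.\<close>
  define g where "g c = b (SOME x. x \<in> V \<and> p x = c)" for c
  have "g (p x) = b x" if "x \<in> V" for x
    using someI[of "\<lambda>z. z \<in> V \<and> p z = p x" x] that unfolding g_def by (intro same) auto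
  then have "b ` V \<subseteq> g ` (p ` V)" by force
  then have "card (b ` V) \<le> card (p ` V)"
    using finite_V by (intro surj_card_le) auto
  also have "\<dots> \<le> card {1..m}" using p unfolding optimal_def by (intro card_mono) auto
  finally show False using m by simp
qed

text \<open>A partial class in colour \<open>j\<close> is moved to another colour it meets.\<close>

lemma optimal_vacate:
  assumes p: "optimal p"
  obtains q where "optimal q" "{x \<in> V. q x = j} = int_part p j"
    "\<And>x. x \<in> V \<Longrightarrow> p x \<noteq> j \<Longrightarrow> q x = p x"
proof (cases "\<exists>x\<in>V. p x = j \<and> (\<exists>y\<in>V. b y = b x \<and> p y \<noteq> j)")
  case False
  then have "{x \<in> V. p x = j} = int_part p j" unfolding int_part_def by auto
  with p that show ?thesis by blast
next
  case True
  then obtain x y where xy: "x \<in> V" "p x = j" "y \<in> V" "b y = b x" "p y \<noteq> j" by blast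
  let ?S = "{z \<in> V. b z = b x \<and> p z = j}"
  let ?q = "recolour ?S (p y) p"
  have "optimal ?q" using optimal_recolour[OF p xy(3), of ?S] xy by auto
  moreover have "{z \<in> V. ?q z = j} = int_part p j"
  proof (intro set_eqI iffI)
    fix z assume "z \<in> {z \<in> V. ?q z = j}"
    then have z: "z \<in> V" "p z = j" "b z \<noteq> b x"
      using xy by (auto simp: recolour_def split: if_splits)
    \<comment> \<open>The class of \<open>x\<close> is already partial in colour \<open>j\<close>,
      so no other class can be.\<close>
    have "p w = j" if w: "w \<in> V" "b w = b z" for w
      using optimal_one_partial[OF p z(1) w(1) xy(1,3) w(2)] xy z by auto
    then show "z \<in> int_part p j" using z unfolding int_part_def by auto
  next
    fix z assume "z \<in> int_part p j"
    then show "z \<in> {z \<in> V. ?q z = j}"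
      using xy unfolding int_part_def recolour_def by auto
  qed
  moreover have "?q z = p z" if "p z \<noteq> j" for z using that by (simp add: recolour_def)
  ultimately show ?thesis using that by blast
qed

text \<open>Vacating \<open>l\<close> leaves only its integral part there and can only increase the
  loss of \<open>x\<close> in its own colour. Optimality of the vacated colouring compares the two;
  this gives condition (4) of stability.\<close>

lemma optimal_loss_le_int_part:
  assumes p: "optimal p" and x: "x \<in> V" "p x \<noteq> l" and l: "l \<in> {1..m}"
  shows "loss p (p x) (b x) \<le> card (int_part p l)"
proof -
  obtain q where q: "optimal q" "{z \<in> V. q z = l} = int_part p l"
    "\<And>z. z \<in> V \<Longrightarrow> p z \<noteq> l \<Longrightarrow> q z = p z"
    using optimal_vacate[OF p] by metis
  have "loss p (p x) (b x) \<le> loss q (q x) (b x)"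
    by (rule loss_mono) (use q(3) x in auto)
  also have "\<dots> \<le> loss q l (b x)" using optimal_loss_le[OF q(1) x(1) l] .
  also have "\<dots> \<le> card {z \<in> V. q z = l}"
    unfolding loss_def by (rule card_mono_V) auto
  finally show ?thesis using q(2) by simp
qed

text \<open>The class of \<open>x\<close> is split, so the integral part of its colour avoids it and
  is bounded by the loss of \<open>x\<close>. This gives condition (2) of stability.\<close>

lemma optimal_partial_int_part_le:
  assumes p: "optimal p" and x: "x \<in> V" "y \<in> V" "b y = b x" "p y \<noteq> p x" and l: "l \<in> {1..m}"
  shows "card (int_part p (p x)) \<le> card (int_part p l)"
proof (cases "l = p x")
  case False
  have "card (int_part p (p x)) \<le> loss p (p x) (b x)"
    unfolding loss_def int_part_def by (rule card_mono_V) (use x in auto)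
  also have "\<dots> \<le> card (int_part p l)"
    using optimal_loss_le_int_part[OF p x(1) _ l] False by simp
  finally show ?thesis .
qed simp

text \<open>Gather the whole class of \<open>x\<close> in colour \<open>p x\<close>. A vertex
  \<open>a\<close> of another class there then loses at least the size of that class, whereas colour
  \<open>p y\<close> now holds only its integral part. This gives condition (3) of
  stability.\<close>

lemma optimal_partial_class_le:
  assumes p: "optimal p" and m: "m < card (b ` V)"
    and x: "x \<in> V" "y \<in> V" "b y = b x" "p y \<noteq> p x" and l: "l \<in> {1..m}"
  shows "card {z \<in> V. b z = b x} \<le> card (int_part p l)"
proof -
  let ?S = "{z \<in> V. b z = b x}"
  let ?q = "recolour ?S (p x) p"
  have q: "optimal ?q" using optimal_recolour[OF p x(1)] by auto
  \<comment> \<open>Gathering the class in colour \<open>p y\<close> instead removes it from colour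
    \<open>p x\<close>, which is still nonempty by \<open>optimal_surj\<close>; this produces
    \<open>a\<close>.\<close>
  have "optimal (recolour ?S (p y) p)" using optimal_recolour[OF p x(2), of ?S] x by auto
  then obtain a where "a \<in> V" "recolour ?S (p y) p a = p x"
    using optimal_surj m optimal_range[OF p x(1)] by blast
  then have a: "a \<in> V" "p a = p x" "b a \<noteq> b x"
    using x by (auto simp: recolour_def split: if_splits)
  have "card ?S \<le> loss ?q (?q a) (b a)"
    unfolding loss_def by (rule card_mono_V) (use a in \<open>auto simp: recolour_def\<close>)
  also have "\<dots> \<le> loss ?q (p y) (b a)"
    using optimal_loss_le[OF q a(1)] optimal_range[OF p x(2)] by blast
  also have "\<dots> \<le> card (int_part p (p y))"
    unfolding loss_def
  proof (rule card_mono_V)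
    show "{z \<in> V. ?q z = p y \<and> b z \<noteq> b a} \<subseteq> int_part p (p y)"
    proof
      fix z assume "z \<in> {z \<in> V. ?q z = p y \<and> b z \<noteq> b a}"
      then have z: "z \<in> V" "p z = p y" "b z \<noteq> b x"
        using x by (auto simp: recolour_def split: if_splits)
      have "p w = p y" if w: "w \<in> V" "b w = b z" for w
        using optimal_one_partial[OF p z(1) w(1) x(2) x(1) w(2)] x z by auto
      then show "z \<in> int_part p (p y)" using z unfolding int_part_def by auto
    qed
  qed (auto simp: int_part_def)
  also have "\<dots> \<le> card (int_part p l)"
    using optimal_partial_int_part_le[OF p x(2,1) _ _ l] x by simp
  finally show ?thesis .
qed

section \<open>Integral optimal colourings\<close>

lemma optimal_exists:
  assumes "p ` V \<subseteq> {1..m}"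
  obtains q where "optimal q"
proof -
  have bound: "cross q < Suc (card V * card V)" for q
  proof -
    have "cross q \<le> (\<Sum>x\<in>V. \<Sum>y\<in>V. 1)" unfolding cross_def by (intro sum_mono) auto
    then show ?thesis by simp
  qed
  have "\<exists>q. q ` V \<subseteq> {1..m} \<and> (\<forall>q'. q' ` V \<subseteq> {1..m} \<longrightarrow> cross q' \<le> cross q)"
    by (rule ex_has_greatest_nat[where b = "Suc (card V * card V)"]) (use assms bound in auto)
  with that show ?thesis unfolding optimal_def by blast
qed

text \<open>Classes are made monochromatic one at a time by \<open>optimal_recolour\<close>;
  \<open>I\<close> collects those already treated, and a later step moves only vertices of its own
  class.\<close>

lemma optimal_integral_exists:
  assumes "p ` V \<subseteq> {1..m}"
  obtains q where "optimal q" "\<And>x y. x \<in> V \<Longrightarrow> y \<in> V \<Longrightarrow> b x = b y \<Longrightarrow> q x = q y"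
proof -
  have "\<exists>q. optimal q \<and> (\<forall>x\<in>V. \<forall>y\<in>V. b x = b y \<longrightarrow> b x \<in> I \<longrightarrow> q x = q y)"
    if "finite I" for I
    using that
  proof induction
    case empty
    obtain q where "optimal q" using optimal_exists[OF assms] by blast
    then show ?case by auto
  next
    case (insert i I)
    then obtain q where q: "optimal q"
      "\<forall>x\<in>V. \<forall>y\<in>V. b x = b y \<longrightarrow> b x \<in> I \<longrightarrow> q x = q y" by blast
    show ?case
    proof (cases "\<exists>w\<in>V. b w = i")
      case True
      then obtain w where w: "w \<in> V" "b w = i" by blast
      have "optimal (recolour {x \<in> V. b x = b w} (q w) q)"
        using optimal_recolour[OF q(1) w(1)] by auto
      moreover have "\<forall>x\<in>V. \<forall>y\<in>V. b x = b y \<longrightarrow> b x \<in> insert i I \<longrightarrow>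
          recolour {x \<in> V. b x = b w} (q w) q x = recolour {x \<in> V. b x = b w} (q w) q y"
      proof (intro ballI impI)
        fix x y assume xy: "x \<in> V" "y \<in> V" "b x = b y" "b x \<in> insert i I"
        show "recolour {x \<in> V. b x = b w} (q w) q x = recolour {x \<in> V. b x = b w} (q w) q y"
        proof (cases "b x = i")
          case False
          then have "q x = q y" using q(2) xy by blast
          with False show ?thesis using xy w by (simp add: recolour_def)
        qed (use xy w in \<open>simp add: recolour_def\<close>)
      qed
      ultimately show ?thesis by (intro exI[of _ "recolour {x \<in> V. b x = b w} (q w) q"] conjI)
    next
      case False
      then have "\<forall>x\<in>V. \<forall>y\<in>V. b x = b y \<longrightarrow> b x \<in> insert i I \<longrightarrow> q x = q y"
        using q(2) by blast
      with q(1) show ?thesis by (intro exI[of _ q] conjI)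
    qed
  qed
  from this[OF finite_imageI[OF finite_V, of b]] obtain q where q: "optimal q"
    "\<forall>x\<in>V. \<forall>y\<in>V. b x = b y \<longrightarrow> b x \<in> b ` V \<longrightarrow> q x = q y"
    by (elim exE conjE)
  show ?thesis by (rule that[OF q(1)]) (use q(2) in blast)
qed

text \<open>An integral optimal colouring uses all \<open>m\<close> colours, so it induces a
  partition of \<open>{1..r}\<close> into exactly \<open>m\<close> parts, one of the candidates in
  \<open>turan_f\<close>. Consequently every colouring attaining this bound is optimal.\<close>

lemma cross_le_turan_f:
  assumes p: "p ` V \<subseteq> {1..m}" and b: "b ` V = {1..r}" and r: "m < r"
    and n: "\<And>i. i \<in> {1..r} \<Longrightarrow> n i = card {x \<in> V. b x = i}"
  shows "cross p \<le> 2 * turan_f r n (m + 1)"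
proof -
  obtain q where q: "optimal q" and int: "\<And>x y. x \<in> V \<Longrightarrow> y \<in> V \<Longrightarrow> b x = b y \<Longrightarrow> q x = q y"
    using optimal_integral_exists[OF p] by metis
  have surj: "\<exists>x\<in>V. q x = j" if "j \<in> {1..m}" for j
    using optimal_surj[OF q _ that] b r by simp
  define I where "I j = b ` {x \<in> V. q x = j}" for j
  define Q where "Q = I ` {1..m}"
  let ?F = "\<lambda>Q. \<Sum>S | S \<subseteq> Q \<and> card S = 2. \<Prod>I\<in>S. n_of n I"
  have disj: "j = k" if i: "i \<in> I j" "i \<in> I k" for i j k
  proof -
    obtain x where "x \<in> V" "q x = j" "b x = i" using i(1) unfolding I_def by blast
    moreover obtain y where "y \<in> V" "q y = k" "b y = i" using i(2) unfolding I_def by blast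
    ultimately show ?thesis using int[of x y] by simp
  qed
  have Ine: "I j \<noteq> {}" if "j \<in> {1..m}" for j using surj[OF that] unfolding I_def by auto
  have inj: "inj_on I {1..m}"
  proof (rule inj_onI)
    fix j k assume jk: "j \<in> {1..m}" "k \<in> {1..m}" "I j = I k"
    then obtain i where "i \<in> I j" using Ine by blast
    then show "j = k" using disj jk(3) by simp
  qed
  have part: "partition_on {1..r} Q"
  proof (rule partition_onI)
    have "\<Union>Q = b ` V" using optimal_range[OF q] unfolding Q_def I_def by blast
    then show "\<Union>Q = {1..r}" using b by simp
    show "{} \<notin> Q" using Ine unfolding Q_def by fastforce
    show "disjnt S T" if "S \<in> Q" "T \<in> Q" "S \<noteq> T" for S T
      using that disj unfolding Q_def disjnt_iff by blast
  qed
  have cardQ: "card Q = m" unfolding Q_def using card_image[OF inj] by simp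
  have fin: "finite {?F Q | Q. partition_on {1..r} Q \<and> card Q = m + 1 - 1}"
  proof -
    have "{?F Q | Q. partition_on {1..r} Q \<and> card Q = m + 1 - 1} \<subseteq> ?F ` Pow (Pow {1..r})"
      by (auto simp: partition_on_def)
    then show ?thesis by (rule finite_subset) simp
  qed
  have nI: "n_of n (I j) = card {x \<in> V. q x = j}" if "j \<in> {1..m}" for j
  proof -
    have "{x \<in> V. q x = j} = (\<Union>i\<in>I j. {x \<in> V. b x = i})"
    proof (intro set_eqI iffI)
      fix x assume "x \<in> (\<Union>i\<in>I j. {x \<in> V. b x = i})"
      then obtain y where "x \<in> V" "y \<in> V" "q y = j" "b x = b y" unfolding I_def by auto
      then show "x \<in> {x \<in> V. q x = j}" using int[of x y] by simp
    qed (auto simp: I_def)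
    then have "card {x \<in> V. q x = j} = card (\<Union>i\<in>I j. {x \<in> V. b x = i})" by simp
    also have "\<dots> = (\<Sum>i\<in>I j. card {x \<in> V. b x = i})"
      using finite_V by (intro card_UN_disjoint) (auto simp: I_def)
    also have "\<dots> = (\<Sum>i\<in>I j. n i)"
    proof (intro sum.cong refl)
      fix i assume "i \<in> I j"
      then have "i \<in> b ` V" unfolding I_def by blast
      then show "card {x \<in> V. b x = i} = n i" unfolding b by (rule n[symmetric])
    qed
    finally show ?thesis by (simp add: n_of_def)
  qed
  \<comment> \<open>Used for the inner and then the outer sum, turning vertex pairs into pairs of
    colours.\<close>
  have colour_sum: "(\<Sum>x\<in>V. g (q x)) = (\<Sum>j\<in>{1..m}. n_of n (I j) * g j)" for g :: "nat \<Rightarrow> nat"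
  proof -
    have "(\<Sum>x\<in>V. g (q x)) = (\<Sum>j\<in>{1..m}. \<Sum>x | x \<in> V \<and> q x = j. g (q x))"
      using sum.group[of V "{1..m}" q "\<lambda>x. g (q x)"] finite_V q unfolding optimal_def by simp
    also have "\<dots> = (\<Sum>j\<in>{1..m}. n_of n (I j) * g j)"
      by (intro sum.cong refl) (simp add: nI)
    finally show ?thesis .
  qed
  \<comment> \<open>Since \<open>q\<close> is constant on classes, different colours already force
    different classes.\<close>
  have "cross q = (\<Sum>x\<in>V. \<Sum>y\<in>V. of_bool (q x \<noteq> q y))"
    unfolding cross_def
  proof (intro sum.cong refl)
    fix x y assume "x \<in> V" "y \<in> V"
    then show "of_bool (b x \<noteq> b y \<and> q x \<noteq> q y) = of_bool (q x \<noteq> q y)" using int[of x y] by auto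
  qed
  also have "\<dots> = (\<Sum>j\<in>{1..m}. n_of n (I j) * (\<Sum>k\<in>{1..m}. n_of n (I k) * of_bool (j \<noteq> k)))"
  proof -
    have "(\<Sum>x\<in>V. \<Sum>y\<in>V. of_bool (q x \<noteq> q y)) =
        (\<Sum>x\<in>V. \<Sum>k\<in>{1..m}. n_of n (I k) * of_bool (q x \<noteq> k))"
      by (intro sum.cong refl colour_sum)
    also have "\<dots> = (\<Sum>j\<in>{1..m}. n_of n (I j) * (\<Sum>k\<in>{1..m}. n_of n (I k) * of_bool (j \<noteq> k)))"
      by (rule colour_sum)
    finally show ?thesis .
  qed
  also have "\<dots> = (\<Sum>j\<in>{1..m}. \<Sum>k\<in>{1..m}.
      if I j = I k then 0 else \<Prod>J\<in>{I j, I k}. n_of n J)"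
    unfolding sum_distrib_left
  proof (intro sum.cong refl)
    fix j k assume "j \<in> {1..m}" "k \<in> {1..m}"
    then show "n_of n (I j) * (n_of n (I k) * of_bool (j \<noteq> k)) =
        (if I j = I k then 0 else \<Prod>J\<in>{I j, I k}. n_of n J)"
      using inj_on_eq_iff[OF inj, of j k] by simp
  qed
  also have "\<dots> = (\<Sum>A\<in>Q. \<Sum>B\<in>Q. if A = B then 0 else \<Prod>J\<in>{A, B}. n_of n J)"
    unfolding Q_def sum.reindex[OF inj] by simp
  also have "\<dots> = 2 * ?F Q"
    by (rule sum_two_subsets[symmetric]) (simp add: Q_def)
  also have "\<dots> \<le> 2 * turan_f r n (m + 1)"
    unfolding turan_f_def using part cardQ by (intro mult_le_mono2 Max_ge[OF fin]) auto
  finally have "cross q \<le> 2 * turan_f r n (m + 1)" .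
  then show ?thesis using q p unfolding optimal_def by (meson le_trans)
qed

section \<open>Internalization\<close>

text \<open>Partial classes are moved one at a time. By \<open>one\<close>, distinct partial classes
  meet disjoint sets of colours, so earlier moves do not alter the losses relevant to the next
  class, and \<open>eq\<close> makes its move free.\<close>

lemma cross_internalize:
  assumes one: "\<And>x x' y y'. x \<in> V \<Longrightarrow> x' \<in> V \<Longrightarrow> y \<in> V \<Longrightarrow> y' \<in> V \<Longrightarrow> b x' = b x \<Longrightarrow>
      p x' \<noteq> p x \<Longrightarrow> b y' = b y \<Longrightarrow> p y' \<noteq> p y \<Longrightarrow> p x = p y \<Longrightarrow> b x = b y"
    and eq: "\<And>x y. x \<in> V \<Longrightarrow> y \<in> V \<Longrightarrow> b x = b y \<Longrightarrow> loss p (p x) (b y) = loss p (p y) (b y)"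
    and I: "finite I"
      "\<And>i. i \<in> I \<Longrightarrow> \<exists>x\<in>V. \<exists>y\<in>V. b x = i \<and> b y = i \<and> p x \<noteq> p y"
      "\<And>i. i \<in> I \<Longrightarrow> \<exists>x\<in>V. b x = i \<and> p x = c i"
  shows "cross (\<lambda>x. if b x \<in> I then c (b x) else p x) = cross p"
  using I
proof induction
  case (insert i I)
  let ?q = "\<lambda>x. if b x \<in> I then c (b x) else p x"
  let ?S = "{x \<in> V. b x = i}"
  have partial: "\<exists>y\<in>V. b y = b x \<and> p y \<noteq> p x" if "x \<in> V" "b x \<in> insert i I" for x
    using insert.prems(1)[OF that(2)] by metis
  have same: "loss ?q (p v) i = loss p (p v) i" if v: "v \<in> V" "b v = i" for v
  proof -
    have "?q x = p v \<longleftrightarrow> p x = p v" if x: "x \<in> V" "b x \<noteq> i" for x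
    proof (cases "b x \<in> I")
      case True
      \<comment> \<open>Neither the old colours of the class of \<open>x\<close> nor its target,
        which it meets, can be a colour met by class \<open>i\<close>.\<close>
      have neq: "p z \<noteq> p v" if z: "z \<in> V" "b z = b x" for z
        using one[OF z(1) _ v(1)] partial[OF v(1)] partial[OF z(1)] z v x True by auto
      obtain z where "z \<in> V" "b z = b x" "p z = c (b x)"
        using insert.prems(2)[of "b x"] True by auto
      then show ?thesis using neq[of z] neq[OF x(1)] True by simp
    qed simp
    then show ?thesis unfolding loss_def by (intro arg_cong[where f = card]) blast
  qed
  obtain w where w: "w \<in> V" "b w = i" "p w = c i" using insert.prems(2) by blast
  have "(\<Sum>v\<in>?S. loss ?q (?q v) i) = (\<Sum>v\<in>?S. loss ?q (c i) i)"
  proof (intro sum.cong refl)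
    fix v assume v: "v \<in> ?S"
    then show "loss ?q (?q v) i = loss ?q (c i) i"
      using same[of v] same[of w] eq[of v w] w insert.hyps by simp
  qed
  then have "cross (recolour ?S (c i) ?q) = cross ?q"
    using cross_recolour[of ?S i "c i" ?q] by simp
  moreover have "cross (recolour ?S (c i) ?q) =
      cross (\<lambda>x. if b x \<in> insert i I then c (b x) else p x)"
    by (rule cross_cong) (auto simp: recolour_def)
  moreover have "cross ?q = cross p" using insert by simp
  ultimately show ?case by simp
qed simp

end

section \<open>Partitions as colourings\<close>

lemma family_partition_colouring:
  assumes "family_partition V m W"
  obtains p where "p ` V \<subseteq> {1..m}" "\<And>j. j \<in> {1..m} \<Longrightarrow> W j = {x \<in> V. p x = j}"
proof -
  have U: "(\<Union>j\<in>{1..m}. W j) = V" and D: "disjoint_family_on W {1..m}"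
    using assms unfolding family_partition_def by auto
  have "\<forall>x\<in>V. \<exists>j\<in>{1..m}. x \<in> W j" using U by blast
  then obtain p where p: "\<forall>x\<in>V. p x \<in> {1..m} \<and> x \<in> W (p x)" by metis
  have "W j = {x \<in> V. p x = j}" if "j \<in> {1..m}" for j
  proof (intro set_eqI iffI)
    fix x assume x: "x \<in> W j"
    then have "x \<in> V" using U that by blast
    then show "x \<in> {x \<in> V. p x = j}"
      using p x D that unfolding disjoint_family_on_def by blast
  qed (use p in auto)
  with p that show ?thesis by blast
qed

context classed_vertices
begin

lemma card_cross_subgraph:
  assumes b: "b ` V \<subseteq> {1..r}" "\<And>i. i \<in> {1..r} \<Longrightarrow> \<V> i = {x \<in> V. b x = i}"
    and p: "p ` V \<subseteq> {1..m}" "\<And>j. j \<in> {1..m} \<Longrightarrow> P j = {x \<in> V. p x = j}"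
  shows "2 * card (cross_subgraph (complete_multipartite r \<V>) m P) = cross p"
proof -
  let ?E = "cross_subgraph (complete_multipartite r \<V>) m P"
  have V_ex: "(\<exists>i\<in>{1..r}. \<exists>j\<in>{1..r}. i \<noteq> j \<and> x \<in> \<V> i \<and> y \<in> \<V> j) \<longleftrightarrow>
      x \<in> V \<and> y \<in> V \<and> b x \<noteq> b y" for x y
    using b by (auto simp: image_subset_iff)
  have P_ex: "(\<exists>i\<in>{1..m}. \<exists>j\<in>{1..m}. i \<noteq> j \<and> x \<in> P i \<and> y \<in> P j) \<longleftrightarrow>
      x \<in> V \<and> y \<in> V \<and> p x \<noteq> p y" for x y
    using p by (auto simp: image_subset_iff)
  have E: "?E = {e. \<exists>x y. e = {x, y} \<and> x \<in> V \<and> y \<in> V \<and> b x \<noteq> b y \<and> p x \<noteq> p y}"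
  proof (intro set_eqI iffI)
    fix e assume "e \<in> ?E"
    \<comment> \<open>The two conditions on \<open>e\<close> name its endpoints separately, possibly
      in opposite order.\<close>
    then obtain x y x' y' where e: "e = {x, y}" "x \<in> V" "y \<in> V" "b x \<noteq> b y"
      "e = {x', y'}" "p x' \<noteq> p y'"
      unfolding cross_subgraph_def complete_multipartite_def V_ex P_ex by blast
    then have "p x \<noteq> p y" by (auto simp: doubleton_eq_iff)
    with e show "e \<in> {e. \<exists>x y. e = {x, y} \<and> x \<in> V \<and> y \<in> V \<and> b x \<noteq> b y \<and> p x \<noteq> p y}"
      by blast
  next
    fix e assume "e \<in> {e. \<exists>x y. e = {x, y} \<and> x \<in> V \<and> y \<in> V \<and> b x \<noteq> b y \<and> p x \<noteq> p y}"
    then show "e \<in> ?E"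
      unfolding cross_subgraph_def complete_multipartite_def V_ex P_ex by blast
  qed
  have mem: "{x, y} \<in> ?E \<longleftrightarrow> b x \<noteq> b y \<and> p x \<noteq> p y" if "x \<in> V" "y \<in> V" for x y
    unfolding E using that by (auto simp: doubleton_eq_iff)
  have "?E \<subseteq> {S. S \<subseteq> V \<and> card S = 2}"
  proof
    fix e assume "e \<in> ?E"
    then obtain x y where "e = {x, y}" "x \<in> V" "y \<in> V" "b x \<noteq> b y" unfolding E by blast
    moreover from this have "x \<noteq> y" by blast
    ultimately show "e \<in> {S. S \<subseteq> V \<and> card S = 2}" by simp
  qed
  then have "{S. S \<subseteq> V \<and> card S = 2} \<inter> ?E = ?E" by (rule Int_absorb1)
  then have "card ?E = (\<Sum>S | S \<subseteq> V \<and> card S = 2. of_bool (S \<in> ?E))"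
    using finite_V by (simp add: sum_of_bool_eq)
  then have "2 * card ?E = (\<Sum>x\<in>V. \<Sum>y\<in>V. if x = y then 0 else of_bool ({x, y} \<in> ?E))"
    using sum_two_subsets[OF finite_V, of "\<lambda>S. of_bool (S \<in> ?E)"] by simp
  also have "\<dots> = cross p"
    unfolding cross_def using mem by (intro sum.cong refl) auto
  finally show ?thesis .
qed

end

theorem theorem1p2:
  fixes r t :: nat and n :: "nat \<Rightarrow> nat" and V :: "'a set"
    and \<V> \<P> IP :: "nat \<Rightarrow> 'a set"
  assumes "r \<ge> t" and "t \<ge> 3"
    and "\<forall>i\<in>{1..<r}. n i \<ge> n (i + 1)" and "n r \<ge> 1"
    and "family_partition V r \<V>"
    and "\<forall>i\<in>{1..r}. card (\<V> i) = n i"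
    and "family_partition V (t - 1) \<P>"
    and "internalization r \<V> (t - 1) \<P> IP"
  shows "extremal_partition V r n \<V> t \<P> \<longleftrightarrow>
           stable_to r \<V> (t - 1) \<P> \<and> extremal_partition V r n \<V> t IP"
proof -

  \<comment> \<open>Setup: both partitions as colourings\<close>
  define m where "m = t - 1"
  have m: "m < r" "t = m + 1" "t - 1 = m" using assms(1,2) by (auto simp: m_def)
  have n_pos: "n i \<ge> 1" if "i \<in> {1..r}" for i
  proof -
    have "i \<le> r" using that by simp
    then have "1 \<le> i \<longrightarrow> n i \<ge> 1"
    proof (induction rule: inc_induct)
      case (step k)
      then show ?case using assms(3)[rule_format, of k] by auto
    qed (use assms(4) in simp)
    with that show ?thesis by simp
  qed
  obtain b where b: "b ` V \<subseteq> {1..r}" "\<And>i. i \<in> {1..r} \<Longrightarrow> \<V> i = {x \<in> V. b x = i}"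
    by (rule family_partition_colouring[OF assms(5)]) (rule that)
  obtain p where p: "p ` V \<subseteq> {1..m}" "\<And>j. j \<in> {1..m} \<Longrightarrow> \<P> j = {x \<in> V. p x = j}"
    by (rule family_partition_colouring[OF assms(7)[unfolded m(3)]]) (rule that)
  \<comment> \<open>Positive \<open>card\<close> also yields finiteness, as infinite sets have
    \<open>card\<close> 0.\<close>
  have V_ne: "\<V> i \<noteq> {}" "finite (\<V> i)" if "i \<in> {1..r}" for i
    using n_pos[OF that] assms(6) that card_gt_0_iff[of "\<V> i"] by auto
  have "finite V"
    using V_ne(2) assms(5) unfolding family_partition_def by auto
  then interpret classed_vertices V b m by unfold_locales
  have bV: "b ` V = {1..r}" 
  proof (intro equalityI b(1) subsetI)
    fix i assume i: "i \<in> {1..r}"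
    then obtain x where "x \<in> \<V> i" using V_ne(1) by blast
    then show "i \<in> b ` V" unfolding b(2)[OF i] by blast
  qed
  have bR: "b x \<in> {1..r}" if "x \<in> V" for x using that bV by blast
  have pR: "p x \<in> {1..m}" if "x \<in> V" for x using that p(1) by blast
  have n_card: "n i = card {x \<in> V. b x = i}" if "i \<in> {1..r}" for i
    using assms(6)[rule_format, OF that] unfolding b(2)[OF that] by simp

  \<comment> \<open>Dictionary between classes and colourings\<close>
  have part_iff: "partial_in (\<V> i) (\<P> j) \<longleftrightarrow>
      (\<exists>x\<in>V. b x = i \<and> p x = j) \<and> (\<exists>y\<in>V. b y = i \<and> p y \<noteq> j)"
    if "i \<in> {1..r}" "j \<in> {1..m}" for i j
    using b(2)[OF that(1)] p(2)[OF that(2)] unfolding partial_in_def by auto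
  have int_iff: "integral_in (\<V> i) (\<P> j) \<longleftrightarrow> (\<forall>y\<in>V. b y = i \<longrightarrow> p y = j)"
    if "i \<in> {1..r}" "j \<in> {1..m}" for i j
    using b(2)[OF that(1)] p(2)[OF that(2)] unfolding integral_in_def by auto
  have ip: "integral_part r \<V> (\<P> j) = int_part p j" if "j \<in> {1..m}" for j
  proof (intro set_eqI iffI)
    fix x assume "x \<in> integral_part r \<V> (\<P> j)"
    then obtain i where i: "i \<in> {1..r}" "integral_in (\<V> i) (\<P> j)" "x \<in> \<V> i"
      unfolding integral_part_def by blast
    then have "x \<in> V" "b x = i" using b(2)[OF i(1)] by auto
    then show "x \<in> int_part p j"
      using i(2) int_iff[OF i(1) that] unfolding int_part_def by blast
  next
    fix x assume x: "x \<in> int_part p j"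
    then have "x \<in> V" unfolding int_part_def by simp
    then have "x \<in> \<V> (b x)" "integral_in (\<V> (b x)) (\<P> j)"
      using x b(2)[OF bR] int_iff[OF bR that] unfolding int_part_def by auto
    then show "x \<in> integral_part r \<V> (\<P> j)"
      using bR[OF \<open>x \<in> V\<close>] unfolding integral_part_def by blast
  qed
  have pc: "is_partial_class r \<V> (\<P> j) \<longleftrightarrow> (\<exists>x\<in>V. \<exists>y\<in>V. b y = b x \<and> p x = j \<and> p y \<noteq> j)"
    if "j \<in> {1..m}" for j
  proof -
    have "is_partial_class r \<V> (\<P> j) \<longleftrightarrow> (\<exists>i\<in>{1..r}. partial_in (\<V> i) (\<P> j))"
      unfolding is_partial_class_def partial_part_def partial_in_def by blast
    also have "\<dots> \<longleftrightarrow> (\<exists>x\<in>V. \<exists>y\<in>V. b y = b x \<and> p x = j \<and> p y \<noteq> j)"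
      using part_iff[OF _ that] bR by metis
    finally show ?thesis .
  qed
  have pI: "i \<in> partial_indices r \<V> m \<P> \<longleftrightarrow> (\<exists>x\<in>V. \<exists>y\<in>V. b x = i \<and> b y = i \<and> p x \<noteq> p y)" for i
  proof
    assume "i \<in> partial_indices r \<V> m \<P>"
    then obtain j where j: "i \<in> {1..r}" "j \<in> {1..m}" "partial_in (\<V> i) (\<P> j)"
      unfolding partial_indices_def by blast
    then show "\<exists>x\<in>V. \<exists>y\<in>V. b x = i \<and> b y = i \<and> p x \<noteq> p y"
      unfolding part_iff[OF j(1,2)] by blast
  next
    assume "\<exists>x\<in>V. \<exists>y\<in>V. b x = i \<and> b y = i \<and> p x \<noteq> p y"
    then obtain x y where xy: "x \<in> V" "y \<in> V" "b x = i" "b y = i" "p x \<noteq> p y" by blast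
    then have "partial_in (\<V> (b x)) (\<P> (p x))"
      unfolding part_iff[OF bR[OF xy(1)] pR[OF xy(1)]] by fastforce
    then show "i \<in> partial_indices r \<V> m \<P>"
      using bR[OF xy(1)] pR[OF xy(1)] xy(3) unfolding partial_indices_def by blast
  qed
  have one_iff: "one_partial r \<V> m \<P> \<longleftrightarrow>
      (\<forall>x\<in>V. \<forall>x'\<in>V. \<forall>y\<in>V. \<forall>y'\<in>V. b x' = b x \<longrightarrow> p x' \<noteq> p x \<longrightarrow> b y' = b y \<longrightarrow>
        p y' \<noteq> p y \<longrightarrow> p x = p y \<longrightarrow> b x = b y)" (is "_ \<longleftrightarrow> ?one")
  proof -
    have "one_partial r \<V> m \<P> \<longleftrightarrow> (\<forall>j\<in>{1..m}. \<forall>i\<in>{1..r}. \<forall>k\<in>{1..r}.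
        partial_in (\<V> i) (\<P> j) \<longrightarrow> partial_in (\<V> k) (\<P> j) \<longrightarrow> i = k)"
      unfolding one_partial_def by (intro ball_cong refl) (auto simp: card_le_Suc0_iff_eq)
    also have "\<dots> \<longleftrightarrow> ?one"
    proof
      assume L: "\<forall>j\<in>{1..m}. \<forall>i\<in>{1..r}. \<forall>k\<in>{1..r}.
        partial_in (\<V> i) (\<P> j) \<longrightarrow> partial_in (\<V> k) (\<P> j) \<longrightarrow> i = k"
      show ?one
      proof (intro ballI impI)
        fix x x' y y'
        assume h: "x \<in> V" "x' \<in> V" "y \<in> V" "y' \<in> V" "b x' = b x" "p x' \<noteq> p x" "b y' = b y"
          "p y' \<noteq> p y" "p x = p y"
        have "partial_in (\<V> (b x)) (\<P> (p x))" "partial_in (\<V> (b y)) (\<P> (p x))"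
          using h part_iff[OF bR[OF h(1)] pR[OF h(1)]] part_iff[OF bR[OF h(3)] pR[OF h(1)]] by metis+
        then show "b x = b y" using L bR pR h by blast
      qed
    next
      assume R: ?one
      show "\<forall>j\<in>{1..m}. \<forall>i\<in>{1..r}. \<forall>k\<in>{1..r}.
        partial_in (\<V> i) (\<P> j) \<longrightarrow> partial_in (\<V> k) (\<P> j) \<longrightarrow> i = k"
      proof (intro ballI impI)
        fix j i k
        assume h: "j \<in> {1..m}" "i \<in> {1..r}" "k \<in> {1..r}"
          "partial_in (\<V> i) (\<P> j)" "partial_in (\<V> k) (\<P> j)"
        obtain x x' where "x \<in> V" "b x = i" "p x = j" "x' \<in> V" "b x' = i" "p x' \<noteq> j"
          using h part_iff by metis
        moreover obtain y y' where "y \<in> V" "b y = k" "p y = j" "y' \<in> V" "b y' = k" "p y' \<noteq> j"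
          using h part_iff by metis
        ultimately show "i = k" using R by metis
      qed
    qed
    finally show ?thesis .
  qed

  \<comment> \<open>The internalization as a colouring\<close>
  obtain c where c: "\<And>i. i \<in> partial_indices r \<V> m \<P> \<Longrightarrow> c i \<in> {1..m} \<and> \<V> i \<inter> \<P> (c i) \<noteq> {}"
    and IP: "\<And>j. j \<in> {1..m} \<Longrightarrow> IP j = (\<P> j - (\<Union>i\<in>partial_indices r \<V> m \<P>. \<V> i))
      \<union> (\<Union>i\<in>{i \<in> partial_indices r \<V> m \<P>. c i = j}. \<V> i)"
    using assms(8) unfolding internalization_def m(3) by (elim exE conjE) (rule that, erule (1) bspec, erule (1) bspec)
  define I where "I = partial_indices r \<V> m \<P>"
  define q where "q x = (if b x \<in> I then c (b x) else p x)" for x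
  have Ir: "I \<subseteq> {1..r}" unfolding I_def partial_indices_def by auto
  have q1: "q ` V \<subseteq> {1..m}" using c pR unfolding q_def I_def by auto
  have q2: "IP j = {x \<in> V. q x = j}" if "j \<in> {1..m}" for j
  proof -
    have "IP j = ({x \<in> V. p x = j} - (\<Union>i\<in>I. {x \<in> V. b x = i}))
        \<union> (\<Union>i\<in>{i \<in> I. c i = j}. {x \<in> V. b x = i})"
    proof -
      have "(\<Union>i\<in>I'. \<V> i) = (\<Union>i\<in>I'. {x \<in> V. b x = i})" if "I' \<subseteq> I" for I'
        using b(2) Ir that by (intro SUP_cong) auto
      from this[of I] this[of "{i \<in> I. c i = j}"] show ?thesis
        unfolding IP[OF that] I_def[symmetric] p(2)[OF that] by simp
    qed
    also have "\<dots> = {x \<in> V. q x = j}" unfolding q_def by auto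
    finally show ?thesis .
  qed
  have cI: "\<exists>x\<in>V. b x = i \<and> p x = c i" if "i \<in> I" for i
    using c[of i] b(2)[of i] p(2)[of "c i"] that Ir unfolding I_def by blast
  have famIP: "family_partition V m IP"
    using q1 q2 unfolding family_partition_def disjoint_family_on_def by auto
  have exP: "extremal_partition V r n \<V> t \<P> \<longleftrightarrow> cross p = 2 * turan_f r n t"
    using card_cross_subgraph[OF b p] assms(7)[unfolded m(3)]
    unfolding extremal_partition_def m(3) by auto
  have exIP: "extremal_partition V r n \<V> t IP \<longleftrightarrow> cross q = 2 * turan_f r n t"
    using card_cross_subgraph[OF b q1 q2] famIP unfolding extremal_partition_def m(3) by auto

  \<comment> \<open>Shared by both directions: \<open>eq\<close> comes from optimality in one and
    from stability in the other.\<close>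
  have cross_eq: "cross q = cross p"
    if one: "one_partial r \<V> m \<P>"
      and eq: "\<And>x y. x \<in> V \<Longrightarrow> y \<in> V \<Longrightarrow> b x = b y \<Longrightarrow> loss p (p x) (b y) = loss p (p y) (b y)"
    unfolding q_def
  proof (rule cross_internalize)
    show "finite I" using Ir finite_subset by blast
  qed (use one[unfolded one_iff] eq cI pI I_def in blast)+

  \<comment> \<open>Extremal partitions are stable\<close>
  have forward: "stable_to r \<V> m \<P> \<and> cross q = cross p" if "cross p = 2 * turan_f r n t"
  proof
    have opt: "optimal p"
      unfolding optimal_def using p(1) that cross_le_turan_f[OF _ bV m(1) n_card] m(2) by simp
    have mb: "m < card (b ` V)" using bV m by simp
    have one: "one_partial r \<V> m \<P>"
      unfolding one_iff by (intro ballI impI) (rule optimal_one_partial[OF opt])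
    then show "cross q = cross p" using cross_eq optimal_loss_eq[OF opt] by blast
    have part_le: "card (int_part p j) \<le> card (int_part p j')"
      if "j \<in> {1..m}" "j' \<in> {1..m}" "is_partial_class r \<V> (\<P> j)" for j j'
      using that optimal_partial_int_part_le[OF opt _ _ _ _ that(2)] unfolding pc[OF that(1)] by metis
    show "stable_to r \<V> m \<P>"
      unfolding stable_to_def
    proof (intro conjI one ballI impI)
      fix j j' assume "j \<in> {1..m}" "j' \<in> {1..m}"
        "is_partial_class r \<V> (\<P> j)" "is_partial_class r \<V> (\<P> j')"
      then show "card (integral_part r \<V> (\<P> j)) = card (integral_part r \<V> (\<P> j'))"
        using part_le by (simp add: ip le_antisym)
    next
      fix j j' assume j: "j \<in> {1..m}" "j' \<in> {1..m}" "is_partial_class r \<V> (\<P> j)"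
      have "card (int_part p j') \<le> card (\<P> j')"
        unfolding p(2)[OF j(2)] by (rule card_mono_V) (auto simp: int_part_def)
      then show "card (integral_part r \<V> (\<P> j)) \<le> card (\<P> j')"
        using part_le[OF j] j by (simp add: ip)
    next
      fix j i assume j: "j \<in> {1..m}" and i: "i \<in> partial_indices r \<V> m \<P>"
      obtain x y where xy: "x \<in> V" "y \<in> V" "b x = i" "b y = i" "p x \<noteq> p y"
        using i unfolding pI by blast
      then have "card {z \<in> V. b z = b x} \<le> card (int_part p j)"
        using optimal_partial_class_le[OF opt mb xy(1,2) _ _ j] by simp
      then show "card (\<V> i) \<le> card (integral_part r \<V> (\<P> j))"
        using b(2)[OF bR[OF xy(1)]] xy(3) ip[OF j] by simp
    next
      fix j i j'
      assume h: "j \<in> {1..m}" "i \<in> {1..r}" "integral_in (\<V> i) (\<P> j)" "j' \<in> {1..m}" "j' \<noteq> j"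
      obtain x where x: "x \<in> V" "b x = i" using bV h(2) by (metis imageE)
      then have px: "p x = j" using h int_iff by blast
      have "\<P> j - \<V> i = {z \<in> V. p z = j \<and> b z \<noteq> i}"
        using b(2)[OF h(2)] p(2)[OF h(1)] by auto
      then show "card (\<P> j - \<V> i) \<le> card (integral_part r \<V> (\<P> j'))"
        using optimal_loss_le_int_part[OF opt x(1) _ h(4)] px h x ip[OF h(4)]
        by (simp add: loss_def)
    qed
  qed

  \<comment> \<open>Stability makes internalization preserve the edge count\<close>
  have backward: "cross q = cross p" if st: "stable_to r \<V> m \<P>"
  proof (rule cross_eq)
    show one: "one_partial r \<V> m \<P>" using st unfolding stable_to_def by blast
    fix x y assume xy: "x \<in> V" "y \<in> V" "b x = b y"
    show "loss p (p x) (b y) = loss p (p y) (b y)"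
    proof (cases "p x = p y")
      case False
      \<comment> \<open>The class of \<open>u\<close> is the only one partial in its colour, so the
        vertices of other classes there form exactly the integral part. Condition (2) then equates
        these sizes.\<close>
      have L: "loss p (p u) (b u) = card (integral_part r \<V> (\<P> (p u)))"
        if u: "u \<in> V" "v \<in> V" "b v = b u" "p v \<noteq> p u" for u v
      proof -
        have "{z \<in> V. p z = p u \<and> b z \<noteq> b u} = int_part p (p u)"
        proof (intro set_eqI iffI)
          fix z assume z: "z \<in> {z \<in> V. p z = p u \<and> b z \<noteq> b u}"
          have "p w = p u" if "w \<in> V" "b w = b z" for w
            using one[unfolded one_iff, rule_format, of z w u v] that z u by auto
          then show "z \<in> int_part p (p u)" using z unfolding int_part_def by auto
        next
          fix z assume "z \<in> int_part p (p u)"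
          then show "z \<in> {z \<in> V. p z = p u \<and> b z \<noteq> b u}" using u unfolding int_part_def by auto
        qed
        then show ?thesis unfolding loss_def ip[OF pR[OF u(1)]] by simp
      qed
      have "is_partial_class r \<V> (\<P> (p x))" "is_partial_class r \<V> (\<P> (p y))"
        using pc[OF pR[OF xy(1)]] pc[OF pR[OF xy(2)]] xy False by metis+
      then have "card (integral_part r \<V> (\<P> (p x))) = card (integral_part r \<V> (\<P> (p y)))"
        using st pR xy unfolding stable_to_def by blast
      then show ?thesis using L[of x y] L[of y x] xy False by simp
    qed simp
  qed
  show ?thesis
    unfolding exP exIP m(3) using forward backward by metis
qed

end
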